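(* Let $\mathcal{M}$ and $\mathcal{N}$ be two matroids on the same finite ground set $S$, and let $n\ge 1$. Let $F_1,\ldots,F_n\subseteq S$ be pairwise disjoint sets, each of size $n$, and each independent in both $\mathcal{M}$ and $\mathcal{N}$. Then there exists a partial rainbow set $R$ for $(F_1,\ldots,F_n)$ with $|R|\ge n-\sqrt{n}$ such that $R$ is independent in both $\mathcal{M}$ and $\mathcal{N}$.
   Context: For a family of sets $(F_1,\ldots,F_n)$, a partial rainbow function is a partial choice function, i.e. a function defined on a subset of $\{1,\ldots,n\}$ assigning to each $i$ in its domain an element of $F_i$. A partial rainbow set is the range of a partial rainbow function, i.e. a set containing at most one element from each $F_i$ (with elements chosen from different $F_i$'s; here the $F_i$ are disjoint, so this is an ordinary set). *)

theory Defs
  imports Complex_Main "HOL-Library.Disjoint_Sets"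
begin

locale matroid =
  fixes carrier :: "'a set" and indep :: "'a set \<Rightarrow> bool"
  assumes finite_carrier: "finite carrier"
    and indep_subset_carrier: "indep X \<Longrightarrow> X \<subseteq> carrier"
    and indep_empty: "indep {}"
    and indep_subset: "\<lbrakk>indep X; Y \<subseteq> X\<rbrakk> \<Longrightarrow> indep Y"
    and augmentation:
      "\<lbrakk>indep X; indep Y; card X < card Y\<rbrakk> \<Longrightarrow> \<exists>y \<in> Y - X. indep (insert y X)"

text \<open>
  A partial choice function for the family of sets \<open>F i\<close>, \<open>i \<in> I\<close>, is a map whose domain
  is an arbitrary subset of \<open>I\<close>.
\<close>

definition partial_rainbow_function :: "'i set \<Rightarrow> ('i \<Rightarrow> 'a set) \<Rightarrow> ('i \<rightharpoonup> 'a) \<Rightarrow> bool" where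
  "partial_rainbow_function I F f \<longleftrightarrow> dom f \<subseteq> I \<and> (\<forall>i x. f i = Some x \<longrightarrow> x \<in> F i)"

definition partial_rainbow_set :: "'i set \<Rightarrow> ('i \<Rightarrow> 'a set) \<Rightarrow> 'a set \<Rightarrow> bool" where
  "partial_rainbow_set I F R \<longleftrightarrow> (\<exists>f. partial_rainbow_function I F f \<and> R = ran f)"

end

theory Submission
  imports Defs
begin

text \<open>
  Let \<open>T\<close> be a rainbow common independent set of maximum size, and let \<open>J\<close> be the set of the \<open>k\<close>
  indices it misses.  For \<open>J' \<subseteq> J\<close>, call \<open>y \<in> T\<close> reachable from \<open>J'\<close> if some partial rainbow set \<open>X\<close>
  of \<open>(F j)\<close>, \<open>j \<in> J'\<close>, forces \<open>y\<close> into every \<open>B \<subseteq> T\<close> such that each \<open>x \<in> X\<close> is spanned by \<open>B\<close> in the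
  first matroid or by \<open>T - B\<close> in the second one.  Such a \<open>B\<close> always exists: otherwise the matroid
  intersection theorem gives a larger common independent subset of \<open>T \<union> X\<close>, which is still rainbow.
  Passing from \<open>J'\<close> to \<open>insert j J'\<close> increases the number of reachable elements by at least \<open>k\<close>:
  with \<open>D\<close> the elements reachable so far, at least \<open>k + |D|\<close> elements of \<open>F j\<close> extend \<open>T - D\<close> in the
  second matroid, they are independent in the first one, and their fundamental circuits there
  consist of reachable elements.  Hence \<open>k\<^sup>2 \<le> |T| = n - k\<close>.
\<close>

section \<open>Rank and matroid intersection\<close>

text \<open>The independence predicate is an explicit argument so that ranks in two matroids and in
  their contractions can be added in one inequality.\<close>

definition rank_of :: "('a set \<Rightarrow> bool) \<Rightarrow> 'a set \<Rightarrow> nat" where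
  "rank_of indep A = Max (card ` {X. X \<subseteq> A \<and> indep X})"

context matroid
begin

lemma finite_indep: "indep X \<Longrightarrow> finite X"
  using indep_subset_carrier finite_carrier finite_subset by blast

lemma finite_indep_subsets: "finite {X. X \<subseteq> A \<and> indep X}"
  by (rule finite_subset[of _ "Pow carrier"])
    (use indep_subset_carrier finite_carrier in auto)

lemma card_le_rank_of: "\<lbrakk>indep X; X \<subseteq> A\<rbrakk> \<Longrightarrow> card X \<le> rank_of indep A"
  unfolding rank_of_def using finite_indep_subsets by (intro Max_ge) auto

lemma rank_of_witness:
  obtains X where "X \<subseteq> A" "indep X" "card X = rank_of indep A"
proof -
  have "Max (card ` {X. X \<subseteq> A \<and> indep X}) \<in> card ` {X. X \<subseteq> A \<and> indep X}"
    using finite_indep_subsets indep_empty by (intro Max_in) auto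
  then show ?thesis
    using that unfolding rank_of_def by auto
qed

lemma extend_indep:
  assumes "indep X" "indep Y" "card X \<le> card Y"
  obtains Z where "X \<subseteq> Z" "Z \<subseteq> X \<union> Y" "indep Z" "card Z = card Y"
proof -
  have "\<exists>Z. X \<subseteq> Z \<and> Z \<subseteq> X \<union> Y \<and> indep Z \<and> card Z = card Y"
    using assms
  proof (induction "card Y - card X" arbitrary: X)
    case 0
    then show ?case by (intro exI[of _ X]) auto
  next
    case (Suc d)
    then have "card X < card Y" by linarith
    then obtain y where y: "y \<in> Y - X" "indep (insert y X)"
      using augmentation Suc.prems by blast
    have "card (insert y X) = Suc (card X)"
      using y finite_indep[OF Suc.prems(1)] by simp
    then have "d = card Y - card (insert y X)" "card (insert y X) \<le> card Y"
      using Suc.hyps(2) \<open>card X < card Y\<close> by linarith+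
    from Suc.hyps(1)[OF this(1) y(2) Suc.prems(2) this(2)]
    obtain Z where "insert y X \<subseteq> Z" "Z \<subseteq> insert y X \<union> Y" "indep Z" "card Z = card Y"
      by blast
    then show ?case using y by (intro exI[of _ Z]) auto
  qed
  then show ?thesis using that by blast
qed

lemma extend_to_rank_of:
  assumes "indep X" "X \<subseteq> A"
  obtains Z where "X \<subseteq> Z" "Z \<subseteq> A" "indep Z" "card Z = rank_of indep A"
proof -
  obtain Y where Y: "Y \<subseteq> A" "indep Y" "card Y = rank_of indep A"
    by (rule rank_of_witness)
  then obtain Z where "X \<subseteq> Z" "Z \<subseteq> X \<union> Y" "indep Z" "card Z = card Y"
    using extend_indep[OF assms(1) Y(2)] card_le_rank_of[OF assms] by metis
  then show ?thesis using that[of Z] Y assms by auto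
qed

text \<open>A basis of \<open>A \<inter> B\<close> extends to a basis \<open>K\<close> of
  \<open>A \<union> B\<close>; counting \<open>K\<close> inside \<open>A\<close> and inside
  \<open>B\<close> counts \<open>K\<close> once and the part in \<open>A \<inter> B\<close> a second
  time.\<close>

lemma rank_of_submodular:
  "rank_of indep (A \<union> B) + rank_of indep (A \<inter> B) \<le> rank_of indep A + rank_of indep B"
proof -
  obtain J where J: "J \<subseteq> A \<inter> B" "indep J" "card J = rank_of indep (A \<inter> B)"
    by (rule rank_of_witness)
  obtain K where K: "J \<subseteq> K" "K \<subseteq> A \<union> B" "indep K" "card K = rank_of indep (A \<union> B)"
    using extend_to_rank_of[OF J(2), of "A \<union> B"] J(1) by blast
  have fin: "finite K" using K finite_indep by blast
  have "(K \<inter> A) \<union> (K \<inter> B) = K" using K by auto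
  moreover have "card (K \<inter> A) + card (K \<inter> B)
      = card ((K \<inter> A) \<union> (K \<inter> B)) + card ((K \<inter> A) \<inter> (K \<inter> B))"
    using fin by (intro card_Un_Int) auto
  moreover have "card J \<le> card ((K \<inter> A) \<inter> (K \<inter> B))"
    using fin J K by (intro card_mono) auto
  moreover have "card (K \<inter> A) \<le> rank_of indep A" "card (K \<inter> B) \<le> rank_of indep B"
    using indep_subset[OF K(3)] by (auto intro!: card_le_rank_of)
  ultimately show ?thesis using J K by simp
qed

lemma rank_of_insert_loop:
  assumes "\<not> indep {e}"
  shows "rank_of indep (insert e A) = rank_of indep A"
proof -
  have "X \<subseteq> insert e A \<and> indep X \<longleftrightarrow> X \<subseteq> A \<and> indep X" for X
    using indep_subset[of X "{e}"] assms by auto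
  then show ?thesis unfolding rank_of_def by simp
qed

text \<open>Contraction of \<open>e\<close>, kept on the same carrier by turning \<open>e\<close>
  into a loop, so that the ground set of the two matroids stays fixed in the induction
  below.\<close>

lemma matroid_contract:
  assumes "indep {e}"
  shows "matroid carrier (\<lambda>X. e \<notin> X \<and> indep (insert e X))"
proof
  fix X Y
  assume X: "e \<notin> X \<and> indep (insert e X)" and Y: "e \<notin> Y \<and> indep (insert e Y)"
    and "card X < card Y"
  moreover have "finite X" "finite Y"
    using X Y finite_indep[of "insert e X"] finite_indep[of "insert e Y"] by auto
  ultimately have "card (insert e X) < card (insert e Y)" by simp
  then obtain y where "y \<in> insert e Y - insert e X" "indep (insert y (insert e X))"
    using augmentation X Y by blast
  then show "\<exists>y\<in>Y - X. e \<notin> insert y X \<and> indep (insert e (insert y X))"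
    using X by (auto simp: insert_commute)
next
  fix X Y
  assume "e \<notin> X \<and> indep (insert e X)" "Y \<subseteq> X"
  then show "e \<notin> Y \<and> indep (insert e Y)"
    using indep_subset[of "insert e X" "insert e Y"] by auto
qed (use assms finite_carrier indep_subset_carrier in auto)

lemma rank_of_contract:
  assumes "indep {e}"
  shows "rank_of indep (insert e A) \<le> Suc (rank_of (\<lambda>X. e \<notin> X \<and> indep (insert e X)) A)"
proof -
  interpret C: matroid carrier "\<lambda>X. e \<notin> X \<and> indep (insert e X)"
    by (rule matroid_contract[OF assms])
  obtain Z where Z: "{e} \<subseteq> Z" "Z \<subseteq> insert e A" "indep Z"
      "card Z = rank_of indep (insert e A)"
    using extend_to_rank_of[OF assms, of "insert e A"] by blast
  have "insert e (Z - {e}) = Z" using Z by auto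
  then have "card (Z - {e}) \<le> rank_of (\<lambda>X. e \<notin> X \<and> indep (insert e X)) A"
    using Z by (intro C.card_le_rank_of) auto
  then show ?thesis
    using Z card_Suc_Diff1[of Z e] finite_indep[of Z] by auto
qed

text \<open>The fundamental circuit of \<open>x\<close> over \<open>T\<close> cannot lie in
  \<open>insert x D\<close>, so it has an element \<open>z\<close> outside \<open>D\<close>. Without
  circuits: extending \<open>insert x D\<close> from \<open>T\<close> to size \<open>card T\<close>
  leaves out exactly one such \<open>z\<close>.\<close>

lemma indep_exchange:
  assumes T: "indep T" and D: "D \<subseteq> T" "indep (insert x D)"
    and x: "x \<notin> T" "\<not> indep (insert x T)"
  obtains z where "z \<in> T - D" "indep (insert x (T - {z}))"
proof -
  have fin: "finite T" using T by (rule finite_indep)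
  have "D \<subset> T" using D x by auto
  then have "card D < card T" by (rule psubset_card_mono[OF fin])
  then have "card (insert x D) \<le> card T"
    using card_insert_le_m1[of "card T" D x] by simp
  then obtain Q where Q: "insert x D \<subseteq> Q" "Q \<subseteq> insert x D \<union> T" "indep Q" "card Q = card T"
    using extend_indep[OF D(2) T] by blast
  have "\<not> T \<subseteq> Q"
    using Q x indep_subset[OF Q(3), of "insert x T"] by auto
  then obtain z where z: "z \<in> T" "z \<notin> Q" by auto
  have "Q \<subseteq> insert x (T - {z})" using Q z D by auto
  moreover have "card (insert x (T - {z})) = card T"
    using x z fin card_Suc_Diff1[of T z] by simp
  ultimately have "Q = insert x (T - {z})"
    using Q fin by (intro card_subset_eq) auto
  then show ?thesis using that[of z] z Q by auto
qed

end

text \<open>The hard direction of Edmonds' min-max theorem, by deletion and contraction: if deleting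
  \<open>e\<close> breaks the rank bound at some \<open>A\<close>, then contracting \<open>e\<close>
  lowers it by at most one.\<close>

theorem matroid_intersection:
  assumes "finite E" "matroid S indep_M" "matroid S indep_N"
    and "\<And>A. A \<subseteq> E \<Longrightarrow> k \<le> rank_of indep_M A + rank_of indep_N (E - A)"
  shows "\<exists>X \<subseteq> E. indep_M X \<and> indep_N X \<and> k \<le> card X"
  using assms
proof (induction E arbitrary: indep_M indep_N k rule: finite_induct)
  case empty
  interpret M: matroid S indep_M by fact
  interpret N: matroid S indep_N by fact
  have "rank_of indep_M {} = 0"
    by (rule M.rank_of_witness[of "{}"]) auto
  moreover have "rank_of indep_N {} = 0"
    by (rule N.rank_of_witness[of "{}"]) auto
  ultimately have "k = 0" using empty.prems(3)[of "{}"] by simp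
  then show ?case using M.indep_empty N.indep_empty by auto
next
  case (insert e E)
  interpret M: matroid S indep_M by fact
  interpret N: matroid S indep_N by fact
  note bound = insert.prems(3)
  have with_e: "k \<le> rank_of indep_M (insert e A) + rank_of indep_N (E - A)" if "A \<subseteq> E" for A
  proof -
    have "insert e E - insert e A = E - A" using insert.hyps by auto
    then show ?thesis using bound[of "insert e A"] that by auto
  qed
  have without_e: "k \<le> rank_of indep_M A + rank_of indep_N (insert e (E - A))" if "A \<subseteq> E" for A
  proof -
    have "insert e E - A = insert e (E - A)" using insert.hyps that by auto
    then show ?thesis using bound[of A] that by auto
  qed
  show ?case
  proof (cases "\<forall>A \<subseteq> E. k \<le> rank_of indep_M A + rank_of indep_N (E - A)")
    case True
    then obtain X where "X \<subseteq> E" "indep_M X" "indep_N X" "k \<le> card X"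
      using insert.IH[OF insert.prems(1,2), of k] by blast
    then show ?thesis by blast
  next
    case False
    then obtain A where A: "A \<subseteq> E" "rank_of indep_M A + rank_of indep_N (E - A) < k"
      by (auto simp: not_le)
    \<comment> \<open>A loop \<open>e\<close> would not change the rank, so \<open>with_e\<close>
      would contradict the choice of \<open>A\<close>.\<close>
    have eM: "indep_M {e}"
      using A with_e[OF A(1)] M.rank_of_insert_loop[of e A] by (cases "indep_M {e}") auto
    have eN: "indep_N {e}"
      using A without_e[OF A(1)] N.rank_of_insert_loop[of e "E - A"] by (cases "indep_N {e}") auto
    let ?M = "\<lambda>X. e \<notin> X \<and> indep_M (insert e X)" and ?N = "\<lambda>X. e \<notin> X \<and> indep_N (insert e X)"
    \<comment> \<open>Uncrossing \<open>A\<close> with \<open>B\<close>: the cuts at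
      \<open>A \<union> B\<close> and \<open>A \<inter> B\<close> contribute at least
      \<open>2 * k\<close>, the cut at \<open>A\<close> at most \<open>k - 1\<close>. This leaves
      \<open>k + 1\<close>, and each contraction costs one.\<close>
    have "k - 1 \<le> rank_of ?M B + rank_of ?N (E - B)" if B: "B \<subseteq> E" for B
    proof -
      have "A \<inter> insert e B = A \<inter> B" "A \<union> insert e B = insert e (A \<union> B)"
        using A insert.hyps by auto
      then have "rank_of indep_M (insert e (A \<union> B)) + rank_of indep_M (A \<inter> B)
          \<le> rank_of indep_M A + rank_of indep_M (insert e B)"
        using M.rank_of_submodular[of A "insert e B"] by simp
      moreover have "(E - A) \<inter> insert e (E - B) = E - (A \<union> B)"
        "(E - A) \<union> insert e (E - B) = insert e (E - (A \<inter> B))"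
        using insert.hyps by auto
      then have "rank_of indep_N (insert e (E - (A \<inter> B))) + rank_of indep_N (E - (A \<union> B))
          \<le> rank_of indep_N (E - A) + rank_of indep_N (insert e (E - B))"
        using N.rank_of_submodular[of "E - A" "insert e (E - B)"] by simp
      moreover have "A \<union> B \<subseteq> E" "A \<inter> B \<subseteq> E" using A B by auto
      note with_e[OF this(1)] without_e[OF this(2)]
      ultimately have "k + 1 \<le> rank_of indep_M (insert e B) + rank_of indep_N (insert e (E - B))"
        using A(2) by linarith
      then show ?thesis
        using M.rank_of_contract[OF eM, of B] N.rank_of_contract[OF eN, of "E - B"] by linarith
    qed
    then obtain X where X: "X \<subseteq> E" "?M X" "?N X" "k - 1 \<le> card X"
      using insert.IH[OF M.matroid_contract[OF eM] N.matroid_contract[OF eN], of "k - 1"] by blast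
    have "finite X" using X insert.hyps finite_subset by blast
    then have "k \<le> card (insert e X)" using X by simp
    then show ?thesis using X by (intro exI[of _ "insert e X"]) auto
  qed
qed

text \<open>A cut \<open>A\<close> splits \<open>T\<close> into two independent parts. Whichever
  side contains the added \<open>x\<close>, its rank exceeds the size of its part of
  \<open>T\<close>, so every cut has value above \<open>card T\<close>.\<close>

lemma common_indep_augment:
  assumes "matroid S indep_M" "matroid S indep_N"
    and T: "indep_M T" "indep_N T" and X: "finite X" "X \<inter> T = {}"
    and addable: "\<And>B. B \<subseteq> T \<Longrightarrow> \<exists>x\<in>X. indep_M (insert x B) \<and> indep_N (insert x (T - B))"
  shows "\<exists>I \<subseteq> T \<union> X. indep_M I \<and> indep_N I \<and> card T < card I"
proof -
  interpret M: matroid S indep_M by fact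
  interpret N: matroid S indep_N by fact
  have fin: "finite T" using T M.finite_indep by blast
  have "Suc (card T) \<le> rank_of indep_M A + rank_of indep_N (T \<union> X - A)" if A: "A \<subseteq> T \<union> X" for A
  proof -
    let ?B = "T \<inter> A"
    obtain x where x: "x \<in> X" "indep_M (insert x ?B)" "indep_N (insert x (T - ?B))"
      using addable[of ?B] by auto
    have xT: "x \<notin> T" using x X by auto
    have card_T: "card T = card ?B + card (T - ?B)"
      using fin card_Int_Diff[of T A] by (simp add: Diff_Int)
    have B: "card ?B \<le> rank_of indep_M A" "card (T - ?B) \<le> rank_of indep_N (T \<union> X - A)"
      using M.indep_subset[OF T(1)] N.indep_subset[OF T(2)]
      by (auto intro!: M.card_le_rank_of N.card_le_rank_of)
    show ?thesis
    proof (cases "x \<in> A")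
      case True
      then have "card (insert x ?B) \<le> rank_of indep_M A"
        using x by (intro M.card_le_rank_of) auto
      then show ?thesis using xT fin card_T B by simp
    next
      case False
      then have "card (insert x (T - ?B)) \<le> rank_of indep_N (T \<union> X - A)"
        using x by (intro N.card_le_rank_of) auto
      then show ?thesis using xT fin card_T B by simp
    qed
  qed
  then show ?thesis
    using matroid_intersection[OF _ assms(1,2), of "T \<union> X" "Suc (card T)"] fin X(1)
    by (auto simp: Suc_le_eq)
qed

section \<open>Partial rainbow sets\<close>

lemma partial_rainbow_set_empty: "partial_rainbow_set I F {}"
  unfolding partial_rainbow_set_def partial_rainbow_function_def
  by (intro exI[of _ Map.empty]) auto

lemma partial_rainbow_set_mono:
  "\<lbrakk>partial_rainbow_set I F X; I \<subseteq> J\<rbrakk> \<Longrightarrow> partial_rainbow_set J F X"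
  unfolding partial_rainbow_set_def partial_rainbow_function_def by blast

lemma partial_rainbow_set_subset:
  assumes "partial_rainbow_set I F X" "Y \<subseteq> X"
  shows "partial_rainbow_set I F Y"
proof -
  obtain f where f: "partial_rainbow_function I F f" "X = ran f"
    using assms by (auto simp: partial_rainbow_set_def)
  let ?g = "f |` {i. \<exists>y\<in>Y. f i = Some y}"
  have "partial_rainbow_function I F ?g"
    using f(1) by (auto simp: partial_rainbow_function_def restrict_map_def split: if_splits)
  moreover have "Y = ran ?g"
    using assms(2) f(2) by (fastforce simp: ran_def restrict_map_def split: if_splits)
  ultimately show ?thesis by (auto simp: partial_rainbow_set_def)
qed

text \<open>With disjoint index sets, \<open>++\<close> overwrites no choice.\<close>

lemma partial_rainbow_set_Un:
  assumes "partial_rainbow_set I F X" "partial_rainbow_set J F Y" "I \<inter> J = {}"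
  shows "partial_rainbow_set (I \<union> J) F (X \<union> Y)"
proof -
  obtain f g where f: "partial_rainbow_function I F f" "X = ran f"
    and g: "partial_rainbow_function J F g" "Y = ran g"
    using assms by (auto simp: partial_rainbow_set_def)
  have "dom f \<inter> dom g = {}"
    using f(1) g(1) assms(3) unfolding partial_rainbow_function_def by blast
  then have "ran (f ++ g) = X \<union> Y" using f g by (simp add: ran_map_add)
  moreover have "partial_rainbow_function (I \<union> J) F (f ++ g)"
    using f g by (auto simp: partial_rainbow_function_def map_add_Some_iff)
  ultimately show ?thesis unfolding partial_rainbow_set_def by metis
qed

lemma partial_rainbow_set_singleton:
  "\<lbrakk>j \<in> J; x \<in> F j\<rbrakk> \<Longrightarrow> partial_rainbow_set J F {x}"
  unfolding partial_rainbow_set_def partial_rainbow_function_def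
  by (intro exI[of _ "[j \<mapsto> x]"]) (auto split: if_splits)

lemma partial_rainbow_set_insert:
  assumes "partial_rainbow_set J F X" "j \<notin> J" "x \<in> F j"
  shows "partial_rainbow_set (insert j J) F (insert x X)"
  using partial_rainbow_set_Un[OF partial_rainbow_set_singleton[of j "{j}" x F] assms(1)] assms(2,3)
  by simp

lemma partial_rainbow_set_finite:
  assumes "partial_rainbow_set J F X" "finite J"
  shows "finite X"
  using assms by (auto simp: partial_rainbow_set_def partial_rainbow_function_def
      intro: finite_ran finite_subset)

lemma partial_rainbow_set_subset_Union: "partial_rainbow_set J F X \<Longrightarrow> X \<subseteq> (\<Union>j\<in>J. F j)"
  unfolding partial_rainbow_set_def partial_rainbow_function_def ran_def by fastforce

lemma partial_rainbow_function_card_ran: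
  assumes "partial_rainbow_function I F f" "disjoint_family_on F I"
  shows "card (ran f) = card (dom f)"
proof -
  have "inj_on f (dom f)"
  proof (rule inj_onI)
    fix i j assume ij: "i \<in> dom f" "j \<in> dom f" "f i = f j"
    then obtain x where "f i = Some x" "f j = Some x" by auto
    then have "i \<in> I" "j \<in> I" "x \<in> F i \<inter> F j"
      using assms(1) ij by (auto simp: partial_rainbow_function_def)
    then show "i = j" using assms(2) by (auto simp: disjoint_family_on_def)
  qed
  then have "inj_on (\<lambda>i. the (f i)) (dom f)"
    by (auto simp: inj_on_def domIff)
  moreover have "ran f = (\<lambda>i. the (f i)) ` dom f"
    by (force simp: ran_def dom_def)
  ultimately show ?thesis by (simp add: card_image)
qed

section \<open>Counting reachable elements\<close>

text \<open>
  \<open>B\<close> plays the role of one side of a tight cut in the matroid intersection theorem for the ground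
  set \<open>T \<union> X\<close>.
\<close>

definition separates ::
  "('a set \<Rightarrow> bool) \<Rightarrow> ('a set \<Rightarrow> bool) \<Rightarrow> 'a set \<Rightarrow> 'a set \<Rightarrow> 'a set \<Rightarrow> bool" where
  "separates indep_M indep_N T X B \<longleftrightarrow>
    B \<subseteq> T \<and> (\<forall>x\<in>X. \<not> indep_M (insert x B) \<or> \<not> indep_N (insert x (T - B)))"

text \<open>An \<open>X\<close> without separating sets would make all of \<open>T\<close> reachable
  vacuously; \<open>sep_exists\<close> below rules this out.\<close>

definition reachable ::
  "('a set \<Rightarrow> bool) \<Rightarrow> ('a set \<Rightarrow> bool) \<Rightarrow> 'a set \<Rightarrow> ('i \<Rightarrow> 'a set) \<Rightarrow> 'i set \<Rightarrow> 'a set" where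
  "reachable indep_M indep_N T F J =
    {y \<in> T. \<exists>X. partial_rainbow_set J F X \<and> (\<forall>B. separates indep_M indep_N T X B \<longrightarrow> y \<in> B)}"

text \<open>\<open>J\<close> stands for the missed indices. The maximality hypothesis need not say
  that \<open>I\<close> is rainbow, since subsets of \<open>T \<union> X\<close> will be.\<close>

lemma unaugmentable_card_bound:
  assumes "matroid S indep_M" "matroid S indep_N"
    and T: "indep_M T" "indep_N T" and "finite J"
    and F: "\<And>j. j \<in> J \<Longrightarrow> indep_M (F j) \<and> indep_N (F j) \<and> F j \<inter> T = {}"
    and card_F: "\<And>j. j \<in> J \<Longrightarrow> card J + card T \<le> card (F j)"
    and max: "\<And>X I. \<lbrakk>partial_rainbow_set J F X; I \<subseteq> T \<union> X; indep_M I; indep_N I\<rbrakk>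
      \<Longrightarrow> card I \<le> card T"
  shows "card J * card J \<le> card T"
proof -
  interpret M: matroid S indep_M by fact
  interpret N: matroid S indep_N by fact
  let ?sep = "separates indep_M indep_N T" and ?D = "reachable indep_M indep_N T F"
  have fin: "finite T" using T M.finite_indep by blast
  have D_T: "?D J' \<subseteq> T" for J' by (auto simp: reachable_def)
  have sep_exists: "\<exists>B. ?sep X B" if X: "partial_rainbow_set J F X" for X
  proof (rule ccontr)
    assume no_sep: "\<nexists>B. ?sep X B"
    have "X \<inter> T = {}" using partial_rainbow_set_subset_Union[OF X] F by blast
    moreover have "\<exists>x\<in>X. indep_M (insert x B) \<and> indep_N (insert x (T - B))" if "B \<subseteq> T" for B
      using no_sep that by (auto simp: separates_def)
    ultimately show False
      using common_indep_augment[OF assms(1,2) T partial_rainbow_set_finite[OF X \<open>finite J\<close>]]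
        max[OF X] by (meson not_le)
  qed
  have step: "card (?D J') + card J \<le> card (?D (insert j J'))"
    if J': "J' \<subseteq> J" and j: "j \<in> J" "j \<notin> J'" for J' j
  proof -
    have "card (T - ?D J') \<le> card (F j)"
      using card_F[OF j(1)] card_mono[of T "T - ?D J'"] fin by auto
    then obtain Z where Z: "T - ?D J' \<subseteq> Z" "Z \<subseteq> (T - ?D J') \<union> F j" "indep_N Z" "card Z = card (F j)"
      using N.extend_indep[of "T - ?D J'" "F j"] N.indep_subset[OF T(2)] F[OF j(1)] by auto
    \<comment> \<open>The elements of \<open>F j\<close> that extend \<open>T - ?D J'\<close> in the
      second matroid.\<close>
    define X where "X = Z - (T - ?D J')"
    have X: "X \<subseteq> F j" using Z by (auto simp: X_def)
    have "card X = card Z - card (T - ?D J')"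
      unfolding X_def using fin Z by (intro card_Diff_subset) auto
    moreover have "card (T - ?D J') + card (?D J') = card T"
      using card_Diff_subset[of "?D J'" T] card_mono[OF fin D_T[of J']] D_T[of J']
        finite_subset[OF D_T fin] by simp
    ultimately have card_X: "card (?D J') + card J \<le> card X"
      using Z card_F[OF j(1)] by linarith
    \<comment> \<open>Some rainbow \<open>Y\<close> leaves every separating set only the option of
      spanning \<open>x\<close> in the first matroid. If \<open>T\<close> spans \<open>x\<close> in
      the second one, a reachable \<open>z\<close> on its circuit is forced into \<open>B\<close>,
      which frees \<open>x\<close> from \<open>T - B\<close>.\<close>
    have forced: "\<exists>Y. partial_rainbow_set (insert j J') F Y
        \<and> (\<forall>B. ?sep Y B \<longrightarrow> \<not> indep_M (insert x B))"
      if x: "x \<in> X" for x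
    proof (cases "indep_N (insert x T)")
      case True
      then have "indep_N (insert x (T - B))" for B
        by (rule N.indep_subset) auto
      moreover have "partial_rainbow_set (insert j J') F {x}"
        using x X by (intro partial_rainbow_set_singleton[of j]) auto
      ultimately show ?thesis by (intro exI[of _ "{x}"]) (auto simp: separates_def)
    next
      case False
      have "x \<notin> T" using x X F[OF j(1)] by auto
      moreover have "indep_N (insert x (T - ?D J'))"
        using Z x by (intro N.indep_subset[OF Z(3)]) (auto simp: X_def)
      ultimately obtain z where z: "z \<in> T - (T - ?D J')" "indep_N (insert x (T - {z}))"
        using N.indep_exchange[OF T(2), of "T - ?D J'" x] False by auto
      then obtain Y where Y: "partial_rainbow_set J' F Y" "\<And>B. ?sep Y B \<Longrightarrow> z \<in> B"
        by (auto simp: reachable_def)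
      have "\<not> indep_M (insert x B)" if B: "?sep (insert x Y) B" for B
      proof -
        have "?sep Y B" using B by (auto simp: separates_def)
        then have "z \<in> B" by (rule Y)
        then have "indep_N (insert x (T - B))"
          by (intro N.indep_subset[OF z(2)]) auto
        then show ?thesis using B by (auto simp: separates_def)
      qed
      moreover have "partial_rainbow_set (insert j J') F (insert x Y)"
        using x X by (intro partial_rainbow_set_insert[OF Y(1) j(2)]) auto
      ultimately show ?thesis by blast
    qed
    have "card X \<le> card (?D (insert j J'))"
    proof (rule ccontr)
      let ?D' = "?D (insert j J')"
      assume "\<not> card X \<le> card ?D'"
      then obtain x where x: "x \<in> X - ?D'" "indep_M (insert x ?D')"
        using M.augmentation[of ?D' X] M.indep_subset[OF T(1) D_T]
          M.indep_subset[of "F j" X] F[OF j(1)] X by auto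
      obtain Y where Y: "partial_rainbow_set (insert j J') F Y"
        "\<And>B. ?sep Y B \<Longrightarrow> \<not> indep_M (insert x B)"
        using forced x by blast
      \<comment> \<open>A separating set of \<open>Y\<close> exists, lies in \<open>T\<close> and
        spans \<open>x\<close>; hence \<open>T\<close> spans \<open>x\<close> in the first matroid
        and the exchange applies.\<close>
      have "partial_rainbow_set J F Y"
        using partial_rainbow_set_mono[OF Y(1)] J' j by auto
      then obtain B where B: "?sep Y B" using sep_exists by blast
      then have "\<not> indep_M (insert x T)"
        using Y(2)[OF B] M.indep_subset[of "insert x T" "insert x B"]
        by (auto simp: separates_def)
      moreover have "x \<notin> T" using x X F[OF j(1)] by auto
      ultimately obtain z where z: "z \<in> T - ?D'" "indep_M (insert x (T - {z}))"
        using M.indep_exchange[OF T(1) D_T x(2)] by blast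
      \<comment> \<open>Every separating \<open>B\<close> spans \<open>x\<close>, so it cannot avoid
        \<open>z\<close>. Thus \<open>Y\<close> witnesses that \<open>z\<close> is reachable,
        against the choice of \<open>z\<close>.\<close>
      have "z \<in> B" if B: "?sep Y B" for B
      proof (rule ccontr)
        assume "z \<notin> B"
        then have "indep_M (insert x B)"
          using B by (intro M.indep_subset[OF z(2)]) (auto simp: separates_def)
        then show False using Y(2)[OF B] by simp
      qed
      then have "z \<in> ?D'" using z Y(1) by (auto simp: reachable_def)
      then show False using z by simp
    qed
    then show ?thesis using card_X by linarith
  qed
  have "card J' * card J \<le> card (?D J')" if "J' \<subseteq> J" for J'
    using finite_subset[OF that \<open>finite J\<close>] that
  proof (induction J' rule: finite_induct)
    case empty
    then show ?case by simp
  next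
    case (insert j J')
    then show ?case using step[of J' j] by simp
  qed
  from this[of J] show ?thesis using card_mono[OF fin D_T[of J]] by simp
qed

section \<open>A rainbow common independent set of maximum size\<close>

theorem theorem1p4:
  fixes S :: "'a set" and indep_M indep_N :: "'a set \<Rightarrow> bool"
    and n :: nat and F :: "nat \<Rightarrow> 'a set"
  assumes "matroid S indep_M" and "matroid S indep_N"
    and "n \<ge> 1"
    and "\<And>i. i \<in> {1..n} \<Longrightarrow> F i \<subseteq> S"
    and "disjoint_family_on F {1..n}"
    and "\<And>i. i \<in> {1..n} \<Longrightarrow> card (F i) = n"
    and "\<And>i. i \<in> {1..n} \<Longrightarrow> indep_M (F i)"
    and "\<And>i. i \<in> {1..n} \<Longrightarrow> indep_N (F i)"
  shows "\<exists>R. partial_rainbow_set {1..n} F R \<and> real (card R) \<ge> real n - sqrt (real n)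
    \<and> indep_M R \<and> indep_N R"
proof -
  interpret M: matroid S indep_M by fact
  interpret N: matroid S indep_N by fact
  let ?P = "\<lambda>R. partial_rainbow_set {1..n} F R \<and> indep_M R \<and> indep_N R"
  have "?P {}" using partial_rainbow_set_empty M.indep_empty N.indep_empty by blast
  moreover have "\<forall>R. ?P R \<longrightarrow> card R < Suc (card S)"
    using M.indep_subset_carrier M.finite_carrier by (auto simp: less_Suc_eq_le intro: card_mono)
  ultimately have "\<exists>T. ?P T \<and> (\<forall>R. ?P R \<longrightarrow> card R \<le> card T)"
    by (rule ex_has_greatest_nat)
  then obtain T where T: "?P T" and T_max: "\<And>R. ?P R \<Longrightarrow> card R \<le> card T"
    by blast
  obtain f where f: "partial_rainbow_function {1..n} F f" "T = ran f"
    using T by (auto simp: partial_rainbow_set_def)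
  have dom_f: "dom f \<subseteq> {1..n}" using f by (simp add: partial_rainbow_function_def)
  define J where "J = {1..n} - dom f"
  \<comment> \<open>Recording that \<open>T\<close> uses no index of \<open>J\<close> allows it to
    be joined with a rainbow set of \<open>J\<close>.\<close>
  have T_dom: "partial_rainbow_set (dom f) F T"
    using f by (auto simp: partial_rainbow_set_def partial_rainbow_function_def)
  have card_J: "card J + card T = n"
  proof -
    have "card J = n - card (dom f)"
      unfolding J_def using dom_f finite_subset[OF dom_f] by (subst card_Diff_subset) auto
    moreover have "card (dom f) \<le> n" using card_mono[OF _ dom_f] by simp
    ultimately show ?thesis
      using partial_rainbow_function_card_ran[OF f(1) assms(5)] f(2) by simp
  qed
  have "F j \<inter> T = {}" if j: "j \<in> J" for j
  proof -
    have "F j \<inter> F i = {}" if "i \<in> dom f" for i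
      using j that dom_f by (intro disjoint_family_onD[OF assms(5)]) (auto simp: J_def)
    then show ?thesis using partial_rainbow_set_subset_Union[OF T_dom] by blast
  qed
  moreover have "card I \<le> card T"
    if X: "partial_rainbow_set J F X" and I: "I \<subseteq> T \<union> X" "indep_M I" "indep_N I" for X I
  proof (rule T_max)
    have "partial_rainbow_set (dom f \<union> J) F (T \<union> X)"
      using T_dom X by (rule partial_rainbow_set_Un) (auto simp: J_def)
    then have "partial_rainbow_set {1..n} F (T \<union> X)"
      by (rule partial_rainbow_set_mono) (use dom_f in \<open>auto simp: J_def\<close>)
    then show "?P I" using partial_rainbow_set_subset I by blast
  qed
  ultimately have "card J * card J \<le> card T"
    using T assms(6-8) card_J
    by (intro unaugmentable_card_bound[OF assms(1,2), where F = F]) (auto simp: J_def)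
  \<comment> \<open>The sharper bound \<open>n - card J\<close> is weakened here to obtain the
    square root.\<close>
  then have "card J * card J \<le> n" using card_J by simp
  then have "(real (card J))\<^sup>2 \<le> real n"
    by (metis of_nat_le_iff of_nat_mult power2_eq_square)
  then have "real (card J) \<le> sqrt (real n)"
    by (rule real_le_rsqrt)
  then have "real (card T) \<ge> real n - sqrt (real n)" using card_J by linarith
  then show ?thesis using T by blast
qed

end
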